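(* For every integer $m\ge 1$, the graph $J_m$ is $3$-colorable and satisfies $\iota^i(J_m)=m=(n+1)/3$, where $n=3m-1$ is the order of $J_m$. In particular, the upper bound $\iota^i(G)\le (n+1)/3$ for connected $3$-colorable graphs $G$ of order $n$ is sharp.
   Context: Graphs are finite and simple. Operation $\mathcal{O}$ applied at a vertex $x$ of a graph: add a new vertex $x'$ with the same neighborhood as $x$ (with $x$ and $x'$ nonadjacent), and then connect $x'$ to $x$ with a path $x\,y\,y'\,x'$ of length $3$, where $y$ and $y'$ are new vertices. The graph $J_m$ is built as follows. Start with $J_1=K_2$ with vertices labeled $b_0,c_0$. For $i=0,1,\dots,m-2$ in turn, apply Operation $\mathcal{O}$ at $b_i$ in the current graph, labeling the clone of $b_i$ as $a_{i+1}$ and the two interior vertices of the added path between $b_i$ and $a_{i+1}$ as $b_{i+1}$ and $c_{i+1}$. For a set $S$ of vertices of a graph $G$, $N[S]$ denotes $S$ together with all neighbors of vertices of $S$. A set $S\subseteq V(G)$ is an isolating set of $G$ if $G-N[S]$ contains no edge. An independent isolating set is an isolating set that is also an independent set. The independent isolation number $\iota^i(G)$ is the minimum size of an independent isolating set of $G$. *)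

theory Defs
  imports Complex_Main "Graph_Theory.Graph_Theory"
begin

text \<open>
  A finite simple graph is a \<^term>\<open>pair_graph\<close>: a finite, symmetric, loop-free set of ordered
  pairs on a finite vertex set, each undirected edge being represented by its two orientations.
\<close>

definition colorable :: "nat \<Rightarrow> 'a pair_pre_digraph \<Rightarrow> bool" where
  "colorable k G \<longleftrightarrow>
     (\<exists>f :: 'a \<Rightarrow> nat. (\<forall>v \<in> pverts G. f v < k) \<and> (\<forall>(u, v) \<in> parcs G. f u \<noteq> f v))"

definition closed_nbhd :: "'a pair_pre_digraph \<Rightarrow> 'a set \<Rightarrow> 'a set" where
  "closed_nbhd G S = S \<union> {v. \<exists>s \<in> S. (s, v) \<in> parcs G}"

definition isolating_set :: "'a pair_pre_digraph \<Rightarrow> 'a set \<Rightarrow> bool" where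
  "isolating_set G S \<longleftrightarrow>
     S \<subseteq> pverts G \<and> arcs (with_proj G \<restriction> (pverts G - closed_nbhd G S)) = {}"

definition independent_set :: "'a pair_pre_digraph \<Rightarrow> 'a set \<Rightarrow> bool" where
  "independent_set G S \<longleftrightarrow> S \<subseteq> pverts G \<and> (\<forall>u \<in> S. \<forall>v \<in> S. (u, v) \<notin> parcs G)"

definition indep_isolation_number :: "'a pair_pre_digraph \<Rightarrow> nat" where
  "indep_isolation_number G = Min (card ` {S. isolating_set G S \<and> independent_set G S})"

text \<open>The minimum is taken over a finite nonempty set:\<close>

lemma finite_indep_isolating_sets:
  assumes "pair_graph G"
  shows "finite {S. isolating_set G S \<and> independent_set G S}"
proof (rule finite_subset)
  interpret pair_graph G by fact
  show "{S. isolating_set G S \<and> independent_set G S} \<subseteq> Pow (pverts G)"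
    by (auto simp: isolating_set_def)
  show "finite (Pow (pverts G))"
    by simp
qed

lemma indep_isolating_set_exists:
  assumes "pair_graph G"
  shows "\<exists>S. isolating_set G S \<and> independent_set G S"
proof -
  interpret pair_graph G by fact
  have "finite {S. independent_set G S}"
    by (rule finite_subset[of _ "Pow (pverts G)"]) (auto simp: independent_set_def)
  moreover have "{} \<in> {S. independent_set G S}"
    by (simp add: independent_set_def)
  ultimately obtain S where S: "independent_set G S"
    and max: "\<And>T. independent_set G T \<Longrightarrow> S \<subseteq> T \<Longrightarrow> S = T"
    using finite_has_maximal2[of "{S. independent_set G S}" "{}"] by auto
  have "v \<in> closed_nbhd G S" if v: "v \<in> pverts G" for v
  proof (rule ccontr)
    assume out: "v \<notin> closed_nbhd G S"
    have sym: "(s, v) \<in> parcs G" if "(v, s) \<in> parcs G" for s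
      using pair_sym_arcs that by (auto simp: symmetric_def elim: symE)
    have "(v, v) \<notin> parcs G"
      using pair_no_loops by fastforce
    hence "independent_set G (insert v S)"
      using S v out by (auto simp: independent_set_def closed_nbhd_def dest: sym)
    with max[of "insert v S"] out show False
      by (auto simp: closed_nbhd_def)
  qed
  hence "pverts G - closed_nbhd G S = {}"
    by blast
  hence "isolating_set G S"
    using S by (auto simp: isolating_set_def independent_set_def induce_subgraph_def)
  with S show ?thesis
    by blast
qed

text \<open>
  \<open>op_O G x x' y y'\<close> is the result of Operation O at the vertex \<open>x\<close> of \<open>G\<close>, where the names
  \<open>x'\<close> (the clone), \<open>y\<close>, \<open>y'\<close> of the new vertices are supplied by the caller; they are meant
  to be distinct and not in \<open>G\<close>.
\<close>

definition op_O :: "'a pair_pre_digraph \<Rightarrow> 'a \<Rightarrow> 'a \<Rightarrow> 'a \<Rightarrow> 'a \<Rightarrow> 'a pair_pre_digraph" where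
  "op_O G x x' y y' =
     \<lparr> pverts = pverts G \<union> {x', y, y'},
       parcs = parcs G
         \<union> {(x', v) |v. (x, v) \<in> parcs G} \<union> {(v, x') |v. (v, x) \<in> parcs G}
         \<union> {(x, y), (y, x), (y, y'), (y', y), (y', x'), (x', y')} \<rparr>"

datatype vertex = va nat | vb nat | vc nat

text \<open>\<open>J_ops k\<close> is the graph after the operations at \<open>vb 0\<close>, ..., \<open>vb (k - 1)\<close>.\<close>

primrec J_ops :: "nat \<Rightarrow> vertex pair_pre_digraph" where
  "J_ops 0 = \<lparr> pverts = {vb 0, vc 0}, parcs = {(vb 0, vc 0), (vc 0, vb 0)} \<rparr>"
| "J_ops (Suc i) = op_O (J_ops i) (vb i) (va (Suc i)) (vb (Suc i)) (vc (Suc i))"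

text \<open>Only meaningful for \<open>m \<ge> 1\<close>.\<close>

definition J :: "nat \<Rightarrow> vertex pair_pre_digraph" where
  "J m = J_ops (m - 1)"

end

theory Submission
  imports Defs
begin

text \<open>
  Everything rests on one fact about an arbitrary graph \<open>G\<close>: Operation O, applied at any vertex
  \<open>x\<close>, raises the independent isolation number by exactly one
  (\<open>indep_isolation_number_op_O\<close>). Since it also adds exactly three vertices, it raises
  \<open>(n + 1) / 3\<close> by one as well, so the equality of the two, which holds for \<open>K_2\<close>, passes
  along the whole sequence \<open>J_m\<close>. The graphs stay connected because the new path joins
  all new vertices to \<open>x\<close>.

  Why one vertex more suffices: given an independent isolating set \<open>S\<close> of \<open>G\<close>, add the clone
  \<open>x'\<close> if \<open>x\<close> is in \<open>S\<close>, and \<open>y\<close> otherwise (\<open>extend_indep_isolating_set\<close>).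

  Why one vertex more is necessary (\<open>shrink_indep_isolating_set\<close>): to dominate an end of the
  edge \<open>y y'\<close>, an independent isolating set \<open>S\<close> of the new graph has to meet the path
  \<open>x y y' x'\<close>. If it contains \<open>x\<close>, then independence keeps
  \<open>S\<close> away from the common neighbours of \<open>x\<close> and \<open>x'\<close>, so covering the edge \<open>y' x'\<close> forces a
  second path vertex into \<open>S\<close>; the case of \<open>x'\<close> is symmetric, and there \<open>x\<close> takes the place
  of its twin \<open>x'\<close>. If \<open>S\<close> contains neither, its trace on \<open>G\<close> is already isolating: the path
  can help \<open>G\<close> only by \<open>y\<close> dominating \<open>x\<close>, but in this case the path does not dominate \<open>x'\<close>, and
  the covering of the edges at \<open>x'\<close> already covers those at \<open>x\<close> inside \<open>G\<close>. In each case \<open>G\<close> gets an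
  independent isolating set that is strictly smaller than \<open>S\<close>.

  Colorability is inherited because \<open>x'\<close> may repeat the color of \<open>x\<close>, which leaves two further
  colors for \<open>y\<close> and \<open>y'\<close>.
\<close>

section \<open>Symmetry and connectedness of simple graphs\<close>

lemma connected_if_reachable:
  assumes "pair_graph G" "pverts G \<noteq> {}"
    and "\<And>u v. u \<in> pverts G \<Longrightarrow> v \<in> pverts G \<Longrightarrow> u \<rightarrow>\<^sup>*\<^bsub>with_proj G\<^esub> v"
  shows "Digraph_Component.connected (with_proj G)"
proof -
  interpret pair_graph G by fact
  show ?thesis
    unfolding Digraph_Component.connected_def strongly_connected_def
    using assms(2,3) reachable_mk_symmetricI by (simp add: mk_symmetric_def)
qed

lemma pair_graph_arc_sym:
  assumes "pair_graph G" "(u, v) \<in> parcs G"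
  shows "(v, u) \<in> parcs G"
proof -
  interpret pair_graph G by fact
  show ?thesis using pair_sym_arcs assms(2) by (auto simp: symmetric_def elim: symE)
qed

section \<open>Independent isolating sets\<close>

lemma isolating_set_iff:
  assumes "pair_graph G"
  shows "isolating_set G S \<longleftrightarrow>
    S \<subseteq> pverts G \<and> (\<forall>u v. (u, v) \<in> parcs G \<longrightarrow> u \<in> closed_nbhd G S \<or> v \<in> closed_nbhd G S)"
proof -
  interpret pair_graph G by fact
  show ?thesis
    unfolding isolating_set_def using in_arcsD1 in_arcsD2 by fastforce
qed

lemma independent_set_insertI:
  assumes "pair_graph G" "independent_set G S" "t \<in> pverts G"
    and "\<And>s. s \<in> S \<Longrightarrow> (t, s) \<notin> parcs G"
  shows "independent_set G (insert t S)"
proof -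
  interpret pair_graph G by fact
  have "(t, t) \<notin> parcs G"
    using pair_no_loops by fastforce
  moreover have "(s, t) \<notin> parcs G" if "s \<in> S" for s
    using assms(4)[OF that] pair_graph_arc_sym[OF assms(1)] by blast
  ultimately show ?thesis
    using assms(2-4) by (simp add: independent_set_def)
qed

lemma indep_isolation_number_le:
  assumes "pair_graph G" "isolating_set G S" "independent_set G S"
  shows "indep_isolation_number G \<le> card S"
  unfolding indep_isolation_number_def
  using finite_indep_isolating_sets[OF assms(1)] assms(2,3) by (intro Min_le) auto

lemma indep_isolation_number_attained:
  assumes "pair_graph G"
  obtains S where "isolating_set G S" "independent_set G S"
    "card S = indep_isolation_number G"
proof -
  have "indep_isolation_number G \<in> card ` {S. isolating_set G S \<and> independent_set G S}"
    unfolding indep_isolation_number_def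
    using finite_indep_isolating_sets[OF assms] indep_isolating_set_exists[OF assms]
    by (intro Min_in) auto
  then show ?thesis using that by auto
qed

section \<open>Operation O on an arbitrary graph\<close>

locale operation_O = pair_graph G for G :: "'a pair_pre_digraph" +
  fixes x x' y y' :: 'a
  assumes x_in: "x \<in> pverts G"
    and fresh: "x' \<notin> pverts G" "y \<notin> pverts G" "y' \<notin> pverts G"
    and distinct: "x' \<noteq> y" "x' \<noteq> y'" "y \<noteq> y'"
begin

abbreviation H :: "'a pair_pre_digraph" where "H \<equiv> op_O G x x' y y'"

lemma pair_graph_G: "pair_graph G" ..

lemma pverts_H: "pverts H = pverts G \<union> {x', y, y'}"
  by (simp add: op_O_def)

lemma parcs_H:
  "(u, v) \<in> parcs H \<longleftrightarrow> (u, v) \<in> parcs G \<or> u = x' \<and> (x, v) \<in> parcs G \<or> v = x' \<and> (u, x) \<in> parcs G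
     \<or> (u, v) \<in> {(x, y), (y, x), (y, y'), (y', y), (y', x'), (x', y')}"
  by (auto simp: op_O_def)

lemma arc_sym: "(u, v) \<in> parcs G \<Longrightarrow> (v, u) \<in> parcs G"
  using pair_graph_arc_sym[OF pair_graph_G] .

lemma no_loop: "(u, u) \<notin> parcs G"
  using pair_no_loops by fastforce

lemma arc_not_fresh:
  "(u, v) \<in> parcs G \<Longrightarrow> u \<notin> {x', y, y'} \<and> v \<notin> {x', y, y'}"
  using fresh in_arcsD1 in_arcsD2 by blast

lemma x_not_fresh: "x \<noteq> x'" "x \<noteq> y" "x \<noteq> y'"
  using x_in fresh by auto

lemma arc_in_pverts_H:
  assumes "(u, v) \<in> parcs H"
  shows "u \<in> pverts H \<and> v \<in> pverts H"
  using assms x_in in_arcsD1[of u v] in_arcsD2[of u v] in_arcsD2[of x v] in_arcsD1[of u x]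
  by (auto simp: parcs_H pverts_H)

lemma pair_graph_H: "pair_graph H"
proof
  fix e assume e: "e \<in> parcs H"
  then show "fst e \<in> pverts H" "snd e \<in> pverts H"
    using arc_in_pverts_H[of "fst e" "snd e"] by auto
  show "fst e \<noteq> snd e"
    using e no_loop x_not_fresh distinct arc_not_fresh
    by (cases e) (auto simp: parcs_H)
next
  show finV: "finite (pverts H)" by (simp add: pverts_H)
  have "parcs H \<subseteq> pverts H \<times> pverts H"
    by (auto dest: arc_in_pverts_H)
  then show "finite (parcs H)" using finV by (meson finite_SigmaI finite_subset)
next
  show "symmetric (with_proj H)"
    unfolding symmetric_def
  proof (rule symI)
    fix u v assume "(u, v) \<in> arcs_ends (with_proj H)"
    then show "(v, u) \<in> arcs_ends (with_proj H)"
      using arc_sym[of u v] arc_sym[of x v] arc_sym[of u x] by (auto simp: parcs_H)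
  qed
qed

lemma card_pverts_H: "card (pverts H) = card (pverts G) + 3"
  using fresh distinct by (simp add: pverts_H card_Un_disjoint)

lemma colorable_H:
  assumes "colorable 3 G"
  shows "colorable 3 H"
proof -
  from assms obtain f :: "'a \<Rightarrow> nat" where f3: "\<And>v. v \<in> pverts G \<Longrightarrow> f v < 3"
    and f: "\<And>u v. (u, v) \<in> parcs G \<Longrightarrow> f u \<noteq> f v"
    unfolding colorable_def by blast
  define g where "g = f(x' := f x, y := (f x + 1) mod 3, y' := (f x + 2) mod 3)"
  have g_G: "g v = f v" if "v \<in> pverts G" for v
    using that fresh by (auto simp: g_def)
  have g_new: "g x' = f x" "g y = (f x + 1) mod 3" "g y' = (f x + 2) mod 3"
    using distinct by (auto simp: g_def)
  have "f x = 0 \<or> f x = 1 \<or> f x = 2"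
    using f3[OF x_in] by linarith
  then have col: "f x \<noteq> (f x + 1) mod 3" "f x \<noteq> (f x + 2) mod 3"
    "(f x + 1) mod 3 \<noteq> (f x + 2) mod 3"
    by auto
  have "g v < 3" if "v \<in> pverts H" for v
    using that f3 x_in by (auto simp: pverts_H g_new g_G)
  moreover have "g u \<noteq> g v" if uv: "(u, v) \<in> parcs H" for u v
  proof -
    have arc: "g u \<noteq> g v" if "(u, v) \<in> parcs G" for u v
      using f[OF that] g_G in_arcsD1[OF that] in_arcsD2[OF that] by simp
    have twin: "g x' = g x"
      using g_new g_G x_in by simp
    from uv show ?thesis
      unfolding parcs_H using arc arc[of x v] arc[of u x] twin g_new g_G[OF x_in] col by auto
  qed
  ultimately show ?thesis
    unfolding colorable_def by blast
qed

lemma connected_H: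
  assumes "Digraph_Component.connected (with_proj G)"
  shows "Digraph_Component.connected (with_proj H)"
proof -
  interpret H: pair_graph H by (rule pair_graph_H)
  have sub: "subgraph (with_proj G) (with_proj H)"
    by (auto simp: subgraph_def compatible_def pverts_H parcs_H) unfold_locales
  have "strongly_connected (with_proj G)"
    using symmetric_connected_imp_strongly_connected pair_sym_arcs assms by blast
  then have old: "x \<rightarrow>\<^sup>*\<^bsub>with_proj H\<^esub> v" if "v \<in> pverts G" for v
    using that x_in H.reachable_mono[OF _ sub] by (auto simp: strongly_connected_def)
  have x_y: "x \<rightarrow>\<^sup>*\<^bsub>with_proj H\<^esub> y"
    using old[OF x_in] by (rule H.reachable_adj_trans) (simp add: parcs_H)
  then have x_y': "x \<rightarrow>\<^sup>*\<^bsub>with_proj H\<^esub> y'"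
    by (rule H.reachable_adj_trans) (simp add: parcs_H)
  then have x_x': "x \<rightarrow>\<^sup>*\<^bsub>with_proj H\<^esub> x'"
    by (rule H.reachable_adj_trans) (simp add: parcs_H)
  have from_x: "x \<rightarrow>\<^sup>*\<^bsub>with_proj H\<^esub> v" if "v \<in> pverts H" for v
    using that old x_y x_y' x_x' by (auto simp: pverts_H)
  show ?thesis
  proof (rule connected_if_reachable[OF pair_graph_H])
    show "pverts H \<noteq> {}" by (simp add: pverts_H)
    fix u v assume "u \<in> pverts H" "v \<in> pverts H"
    then show "u \<rightarrow>\<^sup>*\<^bsub>with_proj H\<^esub> v"
      using from_x H.symmetric_reachable' H.reachable_trans by blast
  qed
qed

lemma closed_nbhd_H_old:
  assumes "z \<in> pverts G"
  shows "z \<in> closed_nbhd H S \<longleftrightarrow> z \<in> closed_nbhd G (S \<inter> pverts G)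
     \<or> z = x \<and> y \<in> S \<or> x' \<in> S \<and> (x, z) \<in> parcs G"
  using assms fresh x_not_fresh in_arcsD1[of _ z] by (auto simp: closed_nbhd_def parcs_H)

lemma closed_nbhd_H_new:
  shows "x' \<in> closed_nbhd H S \<longleftrightarrow> x' \<in> S \<or> y' \<in> S \<or> (\<exists>s\<in>S. (s, x) \<in> parcs G)"
    and "y \<in> closed_nbhd H S \<longleftrightarrow> y \<in> S \<or> x \<in> S \<or> y' \<in> S"
    and "y' \<in> closed_nbhd H S \<longleftrightarrow> y' \<in> S \<or> y \<in> S \<or> x' \<in> S"
  using distinct x_not_fresh arc_not_fresh
  by (auto simp: closed_nbhd_def parcs_H)

text \<open>
  If \<open>x\<close> lies outside \<open>S\<close>, then \<open>y\<close> is a good choice even when \<open>x\<close> is undominated: all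
  neighbours of \<open>x\<close>, which are those of \<open>x'\<close> in the old graph, are then dominated already.
\<close>

lemma extend_indep_isolating_set:
  assumes iso: "isolating_set G S" and ind: "independent_set G S"
  shows "\<exists>T. isolating_set H T \<and> independent_set H T \<and> card T = Suc (card S)"
proof -
  have SG: "S \<subseteq> pverts G"
    using ind by (simp add: independent_set_def)
  then have finS: "finite S"
    by (auto intro: finite_subset)
  have S_new: "x' \<notin> S" "y \<notin> S" "y' \<notin> S"
    using SG fresh by auto
  define t where "t = (if x \<in> S then x' else y)"
  let ?T = "insert t S"
  have trace: "?T \<inter> pverts G = S"
    using SG fresh by (auto simp: t_def)
  have old: "z \<in> closed_nbhd H ?T" if "z \<in> closed_nbhd G S" "z \<in> pverts G" for z
    using closed_nbhd_H_old[OF that(2), of ?T] that(1) trace by simp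
  have new: "y \<in> closed_nbhd H ?T" "y' \<in> closed_nbhd H ?T"
    by (auto simp: closed_nbhd_H_new t_def)
  have twin: "x' \<in> closed_nbhd H ?T \<or> v \<in> closed_nbhd H ?T" if xv: "(x, v) \<in> parcs G" for v
  proof -
    from iso xv have "x \<in> closed_nbhd G S \<or> v \<in> closed_nbhd G S"
      by (simp add: isolating_set_iff[OF pair_graph_G])
    then show ?thesis
    proof
      assume "x \<in> closed_nbhd G S"
      then have "x \<in> S \<or> (\<exists>s\<in>S. (s, x) \<in> parcs G)"
        by (auto simp: closed_nbhd_def)
      then show ?thesis
        by (auto simp: closed_nbhd_H_new t_def)
    next
      assume "v \<in> closed_nbhd G S"
      then show ?thesis
        using old xv in_arcsD2 by blast
    qed
  qed
  have "isolating_set H ?T"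
    unfolding isolating_set_iff[OF pair_graph_H]
  proof (intro conjI allI impI)
    show "?T \<subseteq> pverts H"
      using SG by (auto simp: t_def pverts_H)
    fix u v assume "(u, v) \<in> parcs H"
    then consider "(u, v) \<in> parcs G" | "u = x'" "(x, v) \<in> parcs G"
      | "v = x'" "(u, x) \<in> parcs G" | "u \<in> {y, y'} \<or> v \<in> {y, y'}"
      by (auto simp: parcs_H)
    then show "u \<in> closed_nbhd H ?T \<or> v \<in> closed_nbhd H ?T"
    proof cases
      case 1
      with iso have "u \<in> closed_nbhd G S \<or> v \<in> closed_nbhd G S"
        by (simp add: isolating_set_iff[OF pair_graph_G])
      then show ?thesis
        using old in_arcsD1[OF 1] in_arcsD2[OF 1] by blast
    next
      case 2
      then show ?thesis
        using twin by simp
    next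
      case 3
      then show ?thesis
        using twin[OF arc_sym[OF 3(2)]] by blast
    next
      case 4
      then show ?thesis
        using new by auto
    qed
  qed
  moreover have "independent_set H ?T"
  proof (rule independent_set_insertI[OF pair_graph_H])
    show "independent_set H S"
      using ind SG S_new x_not_fresh
      by (simp add: independent_set_def pverts_H parcs_H) blast
    show "t \<in> pverts H"
      by (simp add: t_def pverts_H)
    fix s assume s: "s \<in> S"
    then have "s \<noteq> x'" "s \<noteq> y" "s \<noteq> y'"
      using S_new by auto
    moreover have "(x, s) \<notin> parcs G" if "x \<in> S"
      using ind s that by (simp add: independent_set_def)
    ultimately show "(t, s) \<notin> parcs H"
      using s distinct x_not_fresh arc_not_fresh[of x' s] arc_not_fresh[of y s]
      by (auto simp: t_def parcs_H)
  qed
  moreover have "card ?T = Suc (card S)"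
    using finS S_new by (auto simp: t_def)
  ultimately show ?thesis by blast
qed

text \<open>
  The isolating set of \<open>G\<close> is the trace of \<open>S\<close>, except when \<open>S\<close> uses the clone without \<open>x\<close>:
  then \<open>x\<close> has to take over what \<open>x'\<close> dominates, and two vertices of the path are dropped
  for one added.
\<close>

lemma shrink_indep_isolating_set:
  assumes iso: "isolating_set H S" and ind: "independent_set H S"
  shows "\<exists>T. isolating_set G T \<and> independent_set G T \<and> card T < card S"
proof -
  let ?R = "S \<inter> pverts G"
  have SH: "S \<subseteq> pverts H"
    using ind by (simp add: independent_set_def)
  then have finS: "finite S"
    by (auto intro: finite_subset simp: pverts_H)
  have cover: "u \<in> closed_nbhd H S \<or> v \<in> closed_nbhd H S" if "(u, v) \<in> parcs H" for u v
    using iso that by (simp add: isolating_set_iff[OF pair_graph_H])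
  have indep: "\<not> (u \<in> S \<and> v \<in> S)" if "(u, v) \<in> parcs H" for u v
    using ind that by (auto simp: independent_set_def)
  have path_indep: "\<not> (x \<in> S \<and> y \<in> S)" "\<not> (y \<in> S \<and> y' \<in> S)" "\<not> (y' \<in> S \<and> x' \<in> S)"
    using indep by (auto simp: parcs_H)
  have R_ind: "independent_set G ?R"
    using ind by (auto simp: independent_set_def parcs_H)
  have iso_G: "isolating_set G T"
    if "\<And>z. z \<in> closed_nbhd H S \<Longrightarrow> z \<in> pverts G \<Longrightarrow> z \<in> closed_nbhd G T" "T \<subseteq> pverts G" for T
    unfolding isolating_set_iff[OF pair_graph_G]
  proof (intro conjI allI impI)
    fix u v assume uv: "(u, v) \<in> parcs G"
    then have "(u, v) \<in> parcs H"
      by (simp add: parcs_H)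
    from cover[OF this] show "u \<in> closed_nbhd G T \<or> v \<in> closed_nbhd G T"
      using that(1) in_arcsD1[OF uv] in_arcsD2[OF uv] by blast
  qed (rule that(2))
  consider (x) "x \<in> S" | (clone) "x \<notin> S" "x' \<in> S" | (neither) "x \<notin> S" "x' \<notin> S"
    by blast
  then show ?thesis
  proof cases
    case x
    have no_nbr: "\<not> (\<exists>s\<in>S. (s, x) \<in> parcs G)"
      using x indep parcs_H by blast
    have "(y', x') \<in> parcs H"
      by (simp add: parcs_H)
    then have "x' \<in> S \<or> y' \<in> S"
      using cover[of y' x'] x path_indep no_nbr by (auto simp: closed_nbhd_H_new)
    then have "?R \<subset> S"
      using fresh by auto
    then have less: "card ?R < card S"
      using finS by (rule psubset_card_mono[rotated])
    have "z \<in> closed_nbhd G ?R" if "z \<in> closed_nbhd H S" "z \<in> pverts G" for z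
    proof -
      have "z \<in> closed_nbhd G ?R \<or> (x, z) \<in> parcs G"
        using that x path_indep closed_nbhd_H_old by blast
      then show ?thesis
        using x x_in by (auto simp: closed_nbhd_def)
    qed
    then have "isolating_set G ?R"
      by (intro iso_G) auto
    then show ?thesis
      using R_ind less by blast
  next
    case clone
    \<comment> \<open>A neighbour of \<open>x\<close> is one of \<open>x'\<close>, so \<open>x\<close> can replace its twin in an independent set.\<close>
    have no_nbr: "\<not> (\<exists>s\<in>S. (s, x) \<in> parcs G)"
      using clone indep parcs_H by blast
    have "(x, y) \<in> parcs H"
      by (simp add: parcs_H)
    then have "y \<in> S"
      using cover[of x y] clone path_indep
      unfolding closed_nbhd_H_old[OF x_in] closed_nbhd_H_new
      using no_nbr no_loop by (auto simp: closed_nbhd_def)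
    let ?T = "insert x ?R"
    have "?R \<subseteq> S - {x', y}"
      using fresh by auto
    then have "card ?R \<le> card (S - {x', y})"
      using finS by (intro card_mono) auto
    also have "\<dots> = card S - 2"
      using finS clone \<open>y \<in> S\<close> distinct by (simp add: card_Diff_subset)
    finally have "card ?R \<le> card S - 2" .
    moreover have "card {x', y} \<le> card S"
      using finS clone \<open>y \<in> S\<close> by (intro card_mono) auto
    ultimately have less: "card ?T < card S"
      using distinct finS clone by simp
    have "z \<in> closed_nbhd G ?T" if "z \<in> closed_nbhd H S" "z \<in> pverts G" for z
    proof -
      have "z \<in> closed_nbhd G ?R \<or> z = x \<or> (x, z) \<in> parcs G"
        using that closed_nbhd_H_old by blast
      then show ?thesis
        by (auto simp: closed_nbhd_def)
    qed
    moreover have "?T \<subseteq> pverts G"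
      using x_in by auto
    ultimately have "isolating_set G ?T"
      by (intro iso_G)
    moreover have "independent_set G ?T"
      using R_ind no_nbr x_in by (intro independent_set_insertI[OF pair_graph_G]) (use arc_sym in blast)+
    ultimately show ?thesis
      using less by blast
  next
    case neither
    have "(y, y') \<in> parcs H"
      by (simp add: parcs_H)
    then have "y \<in> S \<or> y' \<in> S"
      using cover[of y y'] neither by (auto simp: closed_nbhd_H_new)
    then have "?R \<subset> S"
      using fresh by auto
    then have less: "card ?R < card S"
      using finS by (rule psubset_card_mono[rotated])
    have old: "z \<in> closed_nbhd G ?R \<or> z = x \<and> y \<in> S"
      if "z \<in> closed_nbhd H S" "z \<in> pverts G" for z
      using that neither by (auto simp: closed_nbhd_H_old)
    \<comment> \<open>If only \<open>y\<close> dominates \<open>x\<close>, nothing dominates \<open>x'\<close>: the edge \<open>x' v\<close> is covered at \<open>v\<close>.\<close>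
    have at_x: "x \<in> closed_nbhd G ?R \<or> v \<in> closed_nbhd G ?R"
      if xv: "(x, v) \<in> parcs G" and y: "y \<in> S" for v
    proof -
      have "(x', v) \<in> parcs H"
        using xv by (simp add: parcs_H)
      then have "x' \<in> closed_nbhd H S \<or> v \<in> closed_nbhd H S"
        by (rule cover)
      then show ?thesis
      proof
        assume "x' \<in> closed_nbhd H S"
        then obtain s where "s \<in> S" "(s, x) \<in> parcs G"
          using neither y path_indep by (auto simp: closed_nbhd_H_new)
        then show ?thesis
          using in_arcsD1 by (auto simp: closed_nbhd_def)
      next
        assume "v \<in> closed_nbhd H S"
        moreover have "v \<noteq> x"
          using xv no_loop by blast
        ultimately show ?thesis
          using old xv in_arcsD2 by blast
      qed
    qed
    have "isolating_set G ?R"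
      unfolding isolating_set_iff[OF pair_graph_G]
    proof (intro conjI allI impI)
      fix u v assume uv: "(u, v) \<in> parcs G"
      then have "(u, v) \<in> parcs H"
        by (simp add: parcs_H)
      from cover[OF this] show "u \<in> closed_nbhd G ?R \<or> v \<in> closed_nbhd G ?R"
        using old[OF _ in_arcsD1[OF uv]] old[OF _ in_arcsD2[OF uv]]
          at_x[of v] at_x[of u] uv arc_sym[OF uv] by blast
    qed simp
    then show ?thesis
      using R_ind less by blast
  qed
qed

lemma indep_isolation_number_op_O:
  "indep_isolation_number H = Suc (indep_isolation_number G)"
proof (rule antisym)
  obtain S where "isolating_set G S" "independent_set G S"
    and S: "card S = indep_isolation_number G"
    using indep_isolation_number_attained[OF pair_graph_G] .
  then obtain T where "isolating_set H T" "independent_set H T" "card T = Suc (card S)"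
    using extend_indep_isolating_set by blast
  then show "indep_isolation_number H \<le> Suc (indep_isolation_number G)"
    using indep_isolation_number_le[OF pair_graph_H] S by metis
next
  obtain S where "isolating_set H S" "independent_set H S"
    and S: "card S = indep_isolation_number H"
    using indep_isolation_number_attained[OF pair_graph_H] .
  then obtain T where "isolating_set G T" "independent_set G T" "card T < card S"
    using shrink_indep_isolating_set by blast
  then show "Suc (indep_isolation_number G) \<le> indep_isolation_number H"
    using indep_isolation_number_le[OF pair_graph_G] S by fastforce
qed

end

section \<open>The graphs \<open>J_m\<close>\<close>

lemma pverts_J_ops: "pverts (J_ops k) = vb ` {..k} \<union> vc ` {..k} \<union> va ` {1..k}"
  by (induction k) (auto simp: op_O_def atMost_Suc atLeastAtMostSuc_conv)

lemma operation_O_J_ops: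
  assumes "pair_graph (J_ops i)"
  shows "operation_O (J_ops i) (vb i) (va (Suc i)) (vb (Suc i)) (vc (Suc i))"
  using assms by (auto simp: operation_O_def operation_O_axioms_def pverts_J_ops)

lemma pair_graph_J_ops: "pair_graph (J_ops k)"
proof (induction k)
  case 0
  show ?case
    by unfold_locales (auto simp: symmetric_def intro!: symI)
next
  case (Suc k)
  then interpret operation_O "J_ops k" "vb k" "va (Suc k)" "vb (Suc k)" "vc (Suc k)"
    by (rule operation_O_J_ops)
  show ?case
    using pair_graph_H by simp
qed

interpretation J_ops:
  operation_O "J_ops k" "vb k" "va (Suc k)" "vb (Suc k)" "vc (Suc k)" for k
  by (rule operation_O_J_ops[OF pair_graph_J_ops])

lemma card_pverts_J_ops: "card (pverts (J_ops k)) = 3 * k + 2"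
  by (induction k) (simp_all add: J_ops.card_pverts_H)

lemma colorable_J_ops: "colorable 3 (J_ops k)"
proof (induction k)
  case 0
  show ?case
    unfolding colorable_def by (intro exI[of _ "\<lambda>v. if v = vb 0 then 0 else 1"]) auto
qed (simp add: J_ops.colorable_H)

lemma connected_J_ops: "Digraph_Component.connected (with_proj (J_ops k))"
proof (induction k)
  case 0
  have "vb 0 \<rightarrow>\<^sup>*\<^bsub>with_proj (J_ops 0)\<^esub> vc 0" "vc 0 \<rightarrow>\<^sup>*\<^bsub>with_proj (J_ops 0)\<^esub> vb 0"
    by (rule J_ops.reachable_adjI; simp)+
  moreover have "w \<rightarrow>\<^sup>*\<^bsub>with_proj (J_ops 0)\<^esub> w" if "w \<in> pverts (J_ops 0)" for w
    using that by (rule J_ops.reachable_refl)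
  ultimately show ?case
    by (intro connected_if_reachable[OF pair_graph_J_ops]) auto
qed (simp add: J_ops.connected_H)

lemma indep_isolation_number_J_ops: "indep_isolation_number (J_ops k) = Suc k"
proof (induction k)
  case 0
  let ?K2 = "J_ops 0"
  have "isolating_set ?K2 {vb 0}"
    unfolding isolating_set_iff[OF pair_graph_J_ops] by (auto simp: closed_nbhd_def)
  moreover have "independent_set ?K2 {vb 0}"
    by (auto simp: independent_set_def)
  ultimately have "indep_isolation_number ?K2 \<le> 1"
    using indep_isolation_number_le[OF pair_graph_J_ops] by fastforce
  moreover obtain S where S: "isolating_set ?K2 S" "card S = indep_isolation_number ?K2"
    using indep_isolation_number_attained[OF pair_graph_J_ops] .
  have "S \<noteq> {}"
    using S(1) unfolding isolating_set_iff[OF pair_graph_J_ops] by (auto simp: closed_nbhd_def)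
  moreover have "finite S"
    using S(1) by (auto simp: isolating_set_def intro: finite_subset)
  ultimately show ?case
    using S(2) by (metis One_nat_def card_0_eq le_SucE le_zero_eq)
qed (simp add: J_ops.indep_isolation_number_op_O)

theorem mainTheorem8:
  shows "(\<forall>m \<ge> 1.
            pair_graph (J m) \<and>
            colorable 3 (J m) \<and>
            card (pverts (J m)) = 3 * m - 1 \<and>
            indep_isolation_number (J m) = m \<and>
            real m = (real (card (pverts (J m))) + 1) / 3)
       \<and> (\<forall>m \<ge> 1. \<exists>G :: vertex pair_pre_digraph.
            pair_graph G \<and> Digraph_Component.connected (with_proj G) \<and> colorable 3 G \<and>
            card (pverts G) = 3 * m - 1 \<and>
            real (indep_isolation_number G) = (real (card (pverts G)) + 1) / 3)"
proof -
  have J: "pair_graph (J m) \<and> Digraph_Component.connected (with_proj (J m)) \<and>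
      colorable 3 (J m) \<and> card (pverts (J m)) = 3 * m - 1 \<and>
      indep_isolation_number (J m) = m \<and> real m = (real (card (pverts (J m))) + 1) / 3"
    if "m \<ge> 1" for m
    using that
    by (auto simp: J_def pair_graph_J_ops connected_J_ops colorable_J_ops
        card_pverts_J_ops indep_isolation_number_J_ops)
  show ?thesis
  proof (intro conjI allI impI)
    fix m :: nat assume "m \<ge> 1"
    from J[OF this] show "\<exists>G :: vertex pair_pre_digraph.
            pair_graph G \<and> Digraph_Component.connected (with_proj G) \<and> colorable 3 G \<and>
            card (pverts G) = 3 * m - 1 \<and>
            real (indep_isolation_number G) = (real (card (pverts G)) + 1) / 3"
      by (intro exI[of _ "J m"]) simp
  qed (use J in blast)+
qed

end
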